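(* Let $P$ be a school choice problem with student set $I$ and school set $S$, and let $I = Y \cup Z$ with $Y \cap Z = \emptyset$ and $Y, Z \neq \emptyset$, where $Y$ is the set of advantaged students and $Z$ the set of marginalized students, such that at every school $s \in S$ every student in $Y$ has higher priority than every student in $Z$. Let $\mathrm{DA}(P)$ denote the student-proposing Deferred Acceptance matching of $P$. Then for every stable-dominating mechanism $M$ and every school $s \in S$, with $\mu = M(P)$, $$|\mu^{-1}_s \cap Y| = |\mathrm{DA}^{-1}_s(P) \cap Y| \quad\text{and}\quad |\mu^{-1}_s \cap Z| = |\mathrm{DA}^{-1}_s(P) \cap Z|.$$ Consequently, if a school $s$ is fully segregated under $\mathrm{DA}(P)$, then $s$ is fully segregated under $M(P)$ for every stable-dominating mechanism $M$.
   Context: A school choice problem $P$ consists of a finite set $I$ of students, a finite set $S$ of schools, for each student $i$ a strict (linear) preference $\succ_i$ over $S$, and for each school $s$ a quota $q_s$ (a positive integer) and a strict (linear) priority order $\triangleright_s$ over $I$. The set $S$ may contain a null school $s_\emptyset$, which has unlimited capacity; students assigned to $s_\emptyset$ are called unassigned. If $S$ contains no null school, it is assumed that $\sum_{s\in S} q_s \ge |I|$, so that matchings exist. A matching $\mu$ is a map $I \to S$, $i \mapsto \mu_i$, with $|\mu^{-1}_s| \le q_s$ for every $s \in S$, where $\mu^{-1}_s = \{i \in I : \mu_i = s\}$. The rank of school $s$ for student $i$ is $\mathrm{rk}_i(s) = |\{s' \in S : s' \succ_i s\}| + 1$ (so the best school has rank 1). The student-proposing Deferred Acceptance (DA) mechanism: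 in round 1 every student applies to her most preferred school, and every school tentatively accepts the highest-priority applicants up to its quota and rejects the rest; in each later round every student rejected in the previous round applies to her next best school, and every school, among its new applicants and its previously accepted students, tentatively keeps the highest-priority ones up to its quota and rejects the rest; the procedure stops when there is a round without any rejection. The resulting matching is denoted $\mathrm{DA}(P)$, with $\mathrm{DA}_i(P)$ the school of student $i$ and $\mathrm{DA}^{-1}_s(P)$ the set of students assigned to $s$. A mechanism $M$ associates to every school choice problem $P$ a matching $M(P)$. A matching $\nu$ for $P$ is stable-dominating if $\mathrm{rk}_i(\nu_i) \le \mathrm{rk}_i(\mathrm{DA}_i(P))$ for every $i \in I$. A mechanism $M$ is stable-dominating if $M(P)$ is a stable-dominating matching for every school choice problem $P$. A school $s$ is fully segregated under a matching $\mu$ if $\mu^{-1}_s \subseteq Y$ or $\mu^{-1}_s \subseteq Z$. *)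

theory Defs
  imports Main "HOL-Library.Extended_Nat" "HOL-Library.While_Combinator"
begin

text \<open>
  Both orders list the better element first: \<open>(s, s') \<in> pref P i\<close> means that student \<open>i\<close>
  strictly prefers \<open>s\<close> to \<open>s'\<close>, and \<open>(i, j) \<in> priority P s\<close> means that \<open>i\<close> has strictly
  higher priority than \<open>j\<close> at \<open>s\<close>. If \<open>null_school P = Some s\<close>, then \<open>s\<close> is the null school,
  and its \<open>quota\<close> entry is ignored (see \<open>capacity\<close>).
\<close>

record ('i, 's) school_choice =
  students :: "'i set"
  schools :: "'s set"
  null_school :: "'s option"
  quota :: "'s \<Rightarrow> nat"
  pref :: "'i \<Rightarrow> 's rel"
  priority :: "'s \<Rightarrow> 'i rel"

definition strict_linear_order_over :: "'a set \<Rightarrow> 'a rel \<Rightarrow> bool" where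
  "strict_linear_order_over A r \<longleftrightarrow> r \<subseteq> A \<times> A \<and> strict_linear_order_on A r"

definition school_choice_problem :: "('i, 's) school_choice \<Rightarrow> bool" where
  "school_choice_problem P \<longleftrightarrow>
     finite (students P) \<and> finite (schools P) \<and>
     (\<forall>i\<in>students P. strict_linear_order_over (schools P) (pref P i)) \<and>
     (\<forall>s\<in>schools P. strict_linear_order_over (students P) (priority P s)) \<and>
     (\<forall>s\<in>schools P. null_school P \<noteq> Some s \<longrightarrow> quota P s > 0) \<and>
     (case null_school P of
        None \<Rightarrow> card (students P) \<le> (\<Sum>s\<in>schools P. quota P s)
      | Some s0 \<Rightarrow> s0 \<in> schools P)"

definition capacity :: "('i, 's) school_choice \<Rightarrow> 's \<Rightarrow> enat" where
  "capacity P s = (if null_school P = Some s then \<infinity> else enat (quota P s))"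

definition assigned :: "('i, 's) school_choice \<Rightarrow> ('i \<Rightarrow> 's) \<Rightarrow> 's \<Rightarrow> 'i set" where
  "assigned P \<mu> s = {i \<in> students P. \<mu> i = s}"

text \<open>Values of \<open>\<mu>\<close> outside \<open>students P\<close> are irrelevant.\<close>

definition matching :: "('i, 's) school_choice \<Rightarrow> ('i \<Rightarrow> 's) \<Rightarrow> bool" where
  "matching P \<mu> \<longleftrightarrow>
     (\<forall>i\<in>students P. \<mu> i \<in> schools P) \<and>
     (\<forall>s\<in>schools P. enat (card (assigned P \<mu> s)) \<le> capacity P s)"

definition rk :: "('i, 's) school_choice \<Rightarrow> 'i \<Rightarrow> 's \<Rightarrow> nat" where
  "rk P i s = card {s' \<in> schools P. (s', s) \<in> pref P i} + 1"

definition best :: "('i, 's) school_choice \<Rightarrow> 'i \<Rightarrow> 's set \<Rightarrow> 's" where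
  "best P i A = (THE s. s \<in> A \<and> (\<forall>s'\<in>A. s' \<noteq> s \<longrightarrow> (s, s') \<in> pref P i))"

text \<open>
  The state \<open>\<mu>\<close> of the Deferred Acceptance procedure maps every student to the school she
  is currently applying to or tentatively held by, so \<open>assigned P \<mu> s\<close> consists of the new
  applicants and the previously held students of \<open>s\<close>. A student is among the highest-priority
  ones up to the quota iff fewer students than the quota in this pool have higher priority.
\<close>

definition rejected :: "('i, 's) school_choice \<Rightarrow> ('i \<Rightarrow> 's) \<Rightarrow> 'i set" where
  "rejected P \<mu> = {i \<in> students P.
     capacity P (\<mu> i) \<le> enat (card {j \<in> assigned P \<mu> (\<mu> i). (j, i) \<in> priority P (\<mu> i)})}"

definition DA_step :: "('i, 's) school_choice \<Rightarrow> ('i \<Rightarrow> 's) \<Rightarrow> 'i \<Rightarrow> 's" where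
  "DA_step P \<mu> i =
     (if i \<in> rejected P \<mu> then best P i {s \<in> schools P. (\<mu> i, s) \<in> pref P i} else \<mu> i)"

definition DA :: "('i, 's) school_choice \<Rightarrow> 'i \<Rightarrow> 's" where
  "DA P = while (\<lambda>\<mu>. rejected P \<mu> \<noteq> {}) (DA_step P) (\<lambda>i. best P i (schools P))"

definition mechanism :: "(('i, 's) school_choice \<Rightarrow> 'i \<Rightarrow> 's) \<Rightarrow> bool" where
  "mechanism M \<longleftrightarrow> (\<forall>P. school_choice_problem P \<longrightarrow> matching P (M P))"

definition stable_dominating :: "('i, 's) school_choice \<Rightarrow> ('i \<Rightarrow> 's) \<Rightarrow> bool" where
  "stable_dominating P \<nu> \<longleftrightarrow> (\<forall>i\<in>students P. rk P i (\<nu> i) \<le> rk P i (DA P i))"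

definition stable_dominating_mechanism ::
    "(('i, 's) school_choice \<Rightarrow> 'i \<Rightarrow> 's) \<Rightarrow> bool" where
  "stable_dominating_mechanism M \<longleftrightarrow>
     mechanism M \<and> (\<forall>P. school_choice_problem P \<longrightarrow> stable_dominating P (M P))"

definition fully_segregated ::
    "('i, 's) school_choice \<Rightarrow> 'i set \<Rightarrow> 'i set \<Rightarrow> ('i \<Rightarrow> 's) \<Rightarrow> 's \<Rightarrow> bool" where
  "fully_segregated P Y Z \<mu> s \<longleftrightarrow> assigned P \<mu> s \<subseteq> Y \<or> assigned P \<mu> s \<subseteq> Z"

end

theory Submission
  imports Defs
begin

text \<open>
  Under \<open>DA P\<close>, a school desired by a student is full and filled with students of higher
  priority. Hence, if a student in \<open>Y\<close> moves into \<open>s\<close> under a dominating matching \<open>\<mu>\<close>, then \<open>s\<close> is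
  full of members of \<open>Y\<close> under \<open>DA P\<close>; if none moves in, the members of \<open>Y\<close> at \<open>s\<close> under \<open>\<mu>\<close> are
  already there under \<open>DA P\<close>. Either way \<open>s\<close> has at most as many members of \<open>Y\<close> under \<open>\<mu>\<close> as under
  \<open>DA P\<close>, and since both counts sum to \<open>card Y\<close> over all schools, they are equal. The argument only
  uses that \<open>Y\<close> is an upper set of every priority order, so it also applies to \<open>students P\<close>, and
  subtracting gives the claim for \<open>Z\<close>.
\<close>

section \<open>Finite strict linear orders\<close>

context
  fixes A :: "'a set" and r :: "'a rel"
  assumes slo: "strict_linear_order_over A r"
begin

lemma slo_trans: "(a, b) \<in> r \<Longrightarrow> (b, c) \<in> r \<Longrightarrow> (a, c) \<in> r"
  using slo unfolding strict_linear_order_over_def strict_linear_order_on_def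
  by (meson transD)

lemma slo_irrefl: "(a, a) \<notin> r"
  using slo unfolding strict_linear_order_over_def strict_linear_order_on_def irrefl_def
  by simp

lemma slo_total: "a \<in> A \<Longrightarrow> b \<in> A \<Longrightarrow> a \<noteq> b \<Longrightarrow> (a, b) \<in> r \<or> (b, a) \<in> r"
  using slo unfolding strict_linear_order_over_def strict_linear_order_on_def total_on_def
  by simp

lemma slo_field: "(a, b) \<in> r \<Longrightarrow> a \<in> A \<and> b \<in> A"
  using slo unfolding strict_linear_order_over_def by blast

lemma slo_acyclic: "acyclic r"
  using slo unfolding strict_linear_order_over_def strict_linear_order_on_def
  by (simp add: acyclic_irrefl trancl_id)

end

context
  fixes A :: "'a set" and r :: "'a rel"
  assumes fin: "finite A" and slo: "strict_linear_order_over A r"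
begin

lemma slo_finite: "finite r"
  using slo fin unfolding strict_linear_order_over_def
  by (meson finite_SigmaI finite_subset)

lemma slo_wf: "wf r"
  using slo_finite slo_acyclic[OF slo] by (rule finite_acyclic_wf)

lemma slo_wf_converse: "wf (r\<inverse>)"
  using slo_finite slo_acyclic[OF slo] by (rule finite_acyclic_wf_converse)

lemma slo_first:
  assumes "B \<subseteq> A" and "B \<noteq> {}"
  obtains m where "m \<in> B" and "\<forall>b\<in>B. b \<noteq> m \<longrightarrow> (m, b) \<in> r"
proof -
  obtain m where m: "m \<in> B" "\<And>y. (y, m) \<in> r \<Longrightarrow> y \<notin> B"
    using wfE_min[OF slo_wf] assms(2) by blast
  have "\<forall>b\<in>B. b \<noteq> m \<longrightarrow> (m, b) \<in> r"
    using m slo_total[OF slo] assms(1) by blast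
  with m(1) show thesis by (rule that)
qed

lemma slo_last:
  assumes "B \<subseteq> A" and "B \<noteq> {}"
  obtains m where "m \<in> B" and "\<forall>b\<in>B. b \<noteq> m \<longrightarrow> (b, m) \<in> r"
proof -
  obtain m where m: "m \<in> B" "\<And>y. (y, m) \<in> r\<inverse> \<Longrightarrow> y \<notin> B"
    using wfE_min[OF slo_wf_converse] assms(2) by blast
  have "\<forall>b\<in>B. b \<noteq> m \<longrightarrow> (b, m) \<in> r"
    using m slo_total[OF slo] assms(1) by blast
  with m(1) show thesis by (rule that)
qed

text \<open>Read \<open>?T\<close> as the \<open>q\<close> first elements of \<open>B\<close>. If it
  misses part of \<open>B\<close>, then the first missed element \<open>m\<close> has at least
  \<open>q\<close> predecessors in \<open>B\<close>, and all of them lie in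
  \<open>?T\<close>.\<close>

lemma card_first_ge:
  assumes "B \<subseteq> A" and "q \<le> card B"
  shows "q \<le> card {j \<in> B. card {k \<in> B. (k, j) \<in> r} < q}" (is "_ \<le> card ?T")
proof (cases "B \<subseteq> ?T")
  case True
  then have "?T = B" by blast
  with assms(2) show ?thesis by simp
next
  case False
  have finB: "finite B" using assms(1) fin by (rule finite_subset)
  obtain m where m: "m \<in> B - ?T" and min: "\<forall>b\<in>B - ?T. b \<noteq> m \<longrightarrow> (m, b) \<in> r"
    using slo_first[of "B - ?T"] False assms(1) by blast
  have "q \<le> card {k \<in> B. (k, m) \<in> r}" using m by auto
  also have "\<dots> \<le> card ?T"
  proof (rule card_mono)
    show "finite ?T" using finB by simp
    have "k \<in> ?T" if "k \<in> B" "(k, m) \<in> r" for k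
    proof (rule ccontr)
      assume "k \<notin> ?T"
      then have "k = m \<or> (m, k) \<in> r" using that(1) min by blast
      then have "(m, m) \<in> r" using that(2) slo_trans[OF slo] by metis
      then show False using slo_irrefl[OF slo] by metis
    qed
    then show "{k \<in> B. (k, m) \<in> r} \<subseteq> ?T" by blast
  qed
  finally show ?thesis .
qed

end

section \<open>Deferred Acceptance\<close>

lemma
  assumes "finite (schools P)" and "strict_linear_order_over (schools P) (pref P i)"
    and "B \<subseteq> schools P" and "B \<noteq> {}"
  shows best_in: "best P i B \<in> B"
    and best_pref: "b \<in> B \<Longrightarrow> b \<noteq> best P i B \<Longrightarrow> (best P i B, b) \<in> pref P i"
proof -
  obtain m where m: "m \<in> B \<and> (\<forall>b\<in>B. b \<noteq> m \<longrightarrow> (m, b) \<in> pref P i)"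
    using slo_first[OF assms] by metis
  moreover have "x = m" if "x \<in> B \<and> (\<forall>b\<in>B. b \<noteq> x \<longrightarrow> (x, b) \<in> pref P i)" for x
    using that m slo_trans[OF assms(2)] slo_irrefl[OF assms(2)] by metis
  ultimately have "best P i B = m"
    unfolding best_def by (rule the_equality)
  with m show "best P i B \<in> B" "b \<in> B \<Longrightarrow> b \<noteq> best P i B \<Longrightarrow> (best P i B, b) \<in> pref P i"
    by simp_all
qed

text \<open>The pool at \<open>s\<close> includes applicants about to be rejected, so the condition
  survives every round: whoever has moved below \<open>s\<close> is outranked by a full quota there.
  An infinite capacity makes the inequality false, so the null school never ranks above
  \<open>\<mu> i\<close>.\<close>

definition DA_inv :: "('i, 's) school_choice \<Rightarrow> ('i \<Rightarrow> 's) \<Rightarrow> bool" where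
  "DA_inv P \<mu> \<longleftrightarrow> (\<forall>i\<in>students P. \<mu> i \<in> schools P \<and>
     (\<forall>s. (s, \<mu> i) \<in> pref P i \<longrightarrow>
        capacity P s \<le> enat (card {j \<in> assigned P \<mu> s. (j, i) \<in> priority P s})))"

text \<open>For matchings this is stability: a blocking pair would need a free seat at
  \<open>s\<close> or a student there with lower priority than \<open>i\<close>.\<close>

definition no_justified_envy_or_waste :: "('i, 's) school_choice \<Rightarrow> ('i \<Rightarrow> 's) \<Rightarrow> bool" where
  "no_justified_envy_or_waste P \<mu> \<longleftrightarrow> (\<forall>i\<in>students P. \<forall>s. (s, \<mu> i) \<in> pref P i \<longrightarrow>
     capacity P s \<le> enat (card (assigned P \<mu> s)) \<and>
     (\<forall>j\<in>assigned P \<mu> s. (j, i) \<in> priority P s))"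

text \<open>Double counting: each student in \<open>A\<close> contributes to exactly one
  summand.\<close>

lemma sum_card_assigned:
  assumes "finite (students P)" and "finite (schools P)"
    and "\<forall>i\<in>students P. \<mu> i \<in> schools P" and "A \<subseteq> students P"
  shows "(\<Sum>s\<in>schools P. card (assigned P \<mu> s \<inter> A)) = card A"
proof -
  have "assigned P \<mu> s \<inter> A = {i \<in> A. \<mu> i = s}" for s
    using assms(4) unfolding assigned_def by blast
  moreover have "(\<Sum>s\<in>schools P. card {i \<in> A. \<mu> i = s}) = (\<Sum>i\<in>A. 1)"
    using assms sum.group[of A "schools P" \<mu> "\<lambda>_. 1::nat"] finite_subset by auto
  ultimately show ?thesis by simp
qed

context
  fixes P :: "('i, 's) school_choice"
  assumes prob: "school_choice_problem P"
begin

section \<open>Finiteness, orders and capacities of a fixed problem\<close>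

lemma fin_students: "finite (students P)"
  and fin_schools: "finite (schools P)"
  and slo_pref: "i \<in> students P \<Longrightarrow> strict_linear_order_over (schools P) (pref P i)"
  and slo_priority: "s \<in> schools P \<Longrightarrow> strict_linear_order_over (students P) (priority P s)"
  using prob unfolding school_choice_problem_def by auto

lemmas pref_trans = slo_trans[OF slo_pref]
lemmas pref_field = slo_field[OF slo_pref]

lemma assigned_subset: "assigned P \<mu> s \<subseteq> students P"
  unfolding assigned_def by blast

lemma finite_assigned: "finite (assigned P \<mu> s)"
  using assigned_subset fin_students by (rule finite_subset)

lemma schools_nonempty: "students P \<noteq> {} \<Longrightarrow> schools P \<noteq> {}"
  using prob unfolding school_choice_problem_def by (auto split: option.splits)

text \<open>A finite bound excludes infinite capacity, which lets the later counting take place in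
  \<open>nat\<close>.\<close>

lemma capacity_le_imp_quota:
  assumes "capacity P s \<le> enat n"
  shows "capacity P s = enat (quota P s)" and "null_school P \<noteq> Some s" and "quota P s \<le> n"
  using assms unfolding capacity_def by (auto split: if_splits)

section \<open>One round of Deferred Acceptance\<close>

text \<open>
  If \<open>i\<close> were rejected by her last school, then all schools would be full and that one would
  have an applicant in excess, contradicting the total capacity.
\<close>

lemma rejected_next_school:
  assumes inv: "DA_inv P \<mu>" and i: "i \<in> rejected P \<mu>"
  shows "{s \<in> schools P. (\<mu> i, s) \<in> pref P i} \<noteq> {}"
proof
  assume last: "{s \<in> schools P. (\<mu> i, s) \<in> pref P i} = {}"
  have iI: "i \<in> students P" using i unfolding rejected_def by blast
  have mui: "\<mu> i \<in> schools P" using inv iI unfolding DA_inv_def by blast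
  let ?H = "\<lambda>s. {j \<in> assigned P \<mu> s. (j, i) \<in> priority P s}"
  have cap: "capacity P s \<le> enat (card (?H s))" if "s \<in> schools P" for s
  proof (cases "s = \<mu> i")
    case True
    with i show ?thesis unfolding rejected_def by simp
  next
    case False
    then have "(s, \<mu> i) \<in> pref P i"
      using slo_total[OF slo_pref[OF iI] that mui] last that by blast
    with inv iI show ?thesis unfolding DA_inv_def by blast
  qed
  have H_le: "card (?H s) \<le> card (assigned P \<mu> s)" for s
    by (intro card_mono finite_assigned) blast
  \<comment> \<open>\<open>i\<close> belongs to her own pool but not to the students above her,
    which makes the inequality at \<open>\<mu> i\<close> strict.\<close>
  have "i \<in> assigned P \<mu> (\<mu> i)" using iI unfolding assigned_def by simp
  then have "?H (\<mu> i) \<subset> assigned P \<mu> (\<mu> i)"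
    using slo_irrefl[OF slo_priority[OF mui]] by blast
  then have H_less: "card (?H (\<mu> i)) < card (assigned P \<mu> (\<mu> i))"
    by (intro psubset_card_mono finite_assigned)
  have "(\<Sum>s\<in>schools P. quota P s) < (\<Sum>s\<in>schools P. card (assigned P \<mu> s))"
    using fin_schools
  proof (rule sum_strict_mono_ex1)
    show "\<forall>s\<in>schools P. quota P s \<le> card (assigned P \<mu> s)"
      using capacity_le_imp_quota(3)[OF cap] H_le le_trans by blast
    show "\<exists>s\<in>schools P. quota P s < card (assigned P \<mu> s)"
      using capacity_le_imp_quota(3)[OF cap[OF mui]] H_less mui le_less_trans by blast
  qed
  also have "\<dots> = card (students P)"
    using sum_card_assigned[OF fin_students fin_schools, of \<mu> "students P"] inv assigned_subset
    unfolding DA_inv_def by (simp add: Int_absorb2)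
  finally have "(\<Sum>s\<in>schools P. quota P s) < card (students P)" .
  \<comment> \<open>By \<open>cap\<close> every school has finite capacity, so none is the null
    school, and the bound on the total quota becomes available.\<close>
  moreover have "null_school P = None"
    using prob capacity_le_imp_quota(2)[OF cap]
    unfolding school_choice_problem_def by (auto split: option.splits)
  ultimately show False
    using prob unfolding school_choice_problem_def by auto
qed

text \<open>The third claim expresses that no school is skipped: a rejection adds only
  \<open>\<mu> i\<close> to the schools above the current one.\<close>

lemma DA_step_rejected:
  assumes "DA_inv P \<mu>" and i: "i \<in> rejected P \<mu>"
  shows "DA_step P \<mu> i \<in> schools P" and "(\<mu> i, DA_step P \<mu> i) \<in> pref P i"
    and "(s, DA_step P \<mu> i) \<in> pref P i \<Longrightarrow> s = \<mu> i \<or> (s, \<mu> i) \<in> pref P i"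
proof -
  have iI: "i \<in> students P" using i unfolding rejected_def by blast
  let ?B = "{s \<in> schools P. (\<mu> i, s) \<in> pref P i}"
  have sub: "?B \<subseteq> schools P" by blast
  have eq: "DA_step P \<mu> i = best P i ?B" using i unfolding DA_step_def by simp
  note B = fin_schools slo_pref[OF iI] sub rejected_next_school[OF assms]
  from best_in[OF B] eq
  show "DA_step P \<mu> i \<in> schools P" "(\<mu> i, DA_step P \<mu> i) \<in> pref P i" by auto
  assume s: "(s, DA_step P \<mu> i) \<in> pref P i"
  have "s \<notin> ?B"
    using best_pref[OF B, of s] s eq pref_trans[OF iI] slo_irrefl[OF slo_pref[OF iI]] by metis
  moreover have "s \<in> schools P" using pref_field[OF iI s] by blast
  moreover have "\<mu> i \<in> schools P" using assms(1) iI unfolding DA_inv_def by blast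
  ultimately show "s = \<mu> i \<or> (s, \<mu> i) \<in> pref P i"
    using slo_total[OF slo_pref[OF iI]] by blast
qed

text \<open>If \<open>s\<close> is newly above \<open>i\<close>, then \<open>s\<close> has just
  rejected her; otherwise the old invariant applies. Either way \<open>?H\<close> contains a full
  quota, and its \<open>quota P s\<close> highest-priority members are not rejected, so they still
  outrank \<open>i\<close> after the round.\<close>

lemma DA_step_inv:
  assumes inv: "DA_inv P \<mu>"
  shows "DA_inv P (DA_step P \<mu>)"
  unfolding DA_inv_def
proof (intro ballI conjI allI impI)
  fix i assume iI: "i \<in> students P"
  show sch: "DA_step P \<mu> i \<in> schools P"
  proof (cases "i \<in> rejected P \<mu>")
    case True
    then show ?thesis using DA_step_rejected(1)[OF inv] by blast
  next
    case False
    then show ?thesis using inv iI unfolding DA_step_def DA_inv_def by simp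
  qed
  fix s assume s: "(s, DA_step P \<mu> i) \<in> pref P i"
  have sS: "s \<in> schools P" using pref_field[OF iI s] by blast
  let ?A = "assigned P \<mu> s"
  let ?H = "{j \<in> ?A. (j, i) \<in> priority P s}"
  have "capacity P s \<le> enat (card ?H)"
  proof (cases "i \<in> rejected P \<mu>")
    case True
    with DA_step_rejected(3)[OF inv True s] inv iI show ?thesis
      unfolding rejected_def DA_inv_def by blast
  next
    case False
    then show ?thesis using inv iI s unfolding DA_step_def DA_inv_def by simp
  qed
  note cap = capacity_le_imp_quota[OF this]
  have "quota P s \<le> card {j \<in> ?H. card {k \<in> ?H. (k, j) \<in> priority P s} < quota P s}"
    (is "_ \<le> card ?T")
  proof (rule card_first_ge[OF fin_students slo_priority[OF sS]])
    show "?H \<subseteq> students P" using assigned_subset by fastforce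
    show "quota P s \<le> card ?H" by (rule cap(3))
  qed
  also have "\<dots> \<le> card {j \<in> assigned P (DA_step P \<mu>) s. (j, i) \<in> priority P s}"
  proof (rule card_mono)
    show "finite {j \<in> assigned P (DA_step P \<mu>) s. (j, i) \<in> priority P s}"
      using finite_assigned by simp
    show "?T \<subseteq> {j \<in> assigned P (DA_step P \<mu>) s. (j, i) \<in> priority P s}"
    proof
      fix j assume j: "j \<in> ?T"
      then have jA: "j \<in> ?A" and ji: "(j, i) \<in> priority P s"
        and few: "card {k \<in> ?H. (k, j) \<in> priority P s} < quota P s"
        by blast+
      \<comment> \<open>Anyone above \<open>j\<close> is also above \<open>i\<close>, so the
        students above \<open>j\<close> are the same in \<open>?H\<close> as in the whole pool
        \<open>?A\<close>. They are fewer than the quota, hence \<open>j\<close> is kept.\<close>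
      have "(k, i) \<in> priority P s" if "(k, j) \<in> priority P s" for k
        using slo_trans[OF slo_priority[OF sS] that ji] .
      then have "{k \<in> ?H. (k, j) \<in> priority P s} = {k \<in> ?A. (k, j) \<in> priority P s}"
        by blast
      with few have "enat (card {k \<in> ?A. (k, j) \<in> priority P s}) < capacity P s"
        using cap(1) by simp
      moreover have "\<mu> j = s" using jA unfolding assigned_def by simp
      ultimately have "j \<notin> rejected P \<mu>" unfolding rejected_def by auto
      with jA ji show "j \<in> {j \<in> assigned P (DA_step P \<mu>) s. (j, i) \<in> priority P s}"
        unfolding DA_step_def assigned_def by simp
    qed
  qed
  finally show "capacity P s
      \<le> enat (card {j \<in> assigned P (DA_step P \<mu>) s. (j, i) \<in> priority P s})"
    using cap(1) by simp
qed

section \<open>Termination of Deferred Acceptance\<close>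

lemma DA_step_decreases:
  assumes inv: "DA_inv P \<mu>" and "rejected P \<mu> \<noteq> {}"
  shows "(\<Sum>i\<in>students P. card {s. (DA_step P \<mu> i, s) \<in> pref P i})
    < (\<Sum>i\<in>students P. card {s. (\<mu> i, s) \<in> pref P i})"
  using fin_students
proof (rule sum_strict_mono_ex1)
  \<comment> \<open>The measure counts the schools below the current one; a rejection removes at
    least the new school from this set.\<close>
  have less: "card {s. (DA_step P \<mu> i, s) \<in> pref P i} < card {s. (\<mu> i, s) \<in> pref P i}"
    if i: "i \<in> rejected P \<mu>" for i
  proof (rule psubset_card_mono)
    have iI: "i \<in> students P" using i unfolding rejected_def by blast
    show "finite {s. (\<mu> i, s) \<in> pref P i}"
      using fin_schools by (rule rev_finite_subset) (use pref_field[OF iI] in blast)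
    note step = DA_step_rejected(2)[OF inv i]
    have "{s. (DA_step P \<mu> i, s) \<in> pref P i} \<subseteq> {s. (\<mu> i, s) \<in> pref P i}"
      using pref_trans[OF iI step] by blast
    then show "{s. (DA_step P \<mu> i, s) \<in> pref P i} \<subset> {s. (\<mu> i, s) \<in> pref P i}"
      using step slo_irrefl[OF slo_pref[OF iI]] by blast
  qed
  show "\<forall>i\<in>students P.
      card {s. (DA_step P \<mu> i, s) \<in> pref P i} \<le> card {s. (\<mu> i, s) \<in> pref P i}"
  proof
    fix i
    show "card {s. (DA_step P \<mu> i, s) \<in> pref P i} \<le> card {s. (\<mu> i, s) \<in> pref P i}"
    proof (cases "i \<in> rejected P \<mu>")
      case True
      with less show ?thesis by (simp add: less_imp_le)
    next
      case False
      then show ?thesis unfolding DA_step_def by simp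
    qed
  qed
  show "\<exists>i\<in>students P.
      card {s. (DA_step P \<mu> i, s) \<in> pref P i} < card {s. (\<mu> i, s) \<in> pref P i}"
    using less assms(2) unfolding rejected_def by blast
qed

text \<open>No school ranks above the first choice, so the capacity condition holds
  vacuously.\<close>

lemma DA_inv_init: "DA_inv P (\<lambda>i. best P i (schools P))"
  unfolding DA_inv_def
proof (intro ballI conjI allI impI)
  fix i assume iI: "i \<in> students P"
  then have ne: "schools P \<noteq> {}" using schools_nonempty by blast
  note B = fin_schools slo_pref[OF iI] subset_refl ne
  show "best P i (schools P) \<in> schools P" using best_in[OF B] .
  fix s assume s: "(s, best P i (schools P)) \<in> pref P i"
  have "s \<in> schools P" using pref_field[OF iI s] by blast
  moreover have "s \<noteq> best P i (schools P)" using s slo_irrefl[OF slo_pref[OF iI]] by metis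
  ultimately have "(best P i (schools P), s) \<in> pref P i" using best_pref[OF B] by blast
  from pref_trans[OF iI s this] have False using slo_irrefl[OF slo_pref[OF iI]] by blast
  then show "capacity P s
      \<le> enat (card {j \<in> assigned P (\<lambda>i. best P i (schools P)) s. (j, i) \<in> priority P s})" ..
qed

text \<open>The invariant also serves termination: it guarantees that a rejected student has a next
  school, and so that the measure falls.\<close>

lemma DA_terminal: "DA_inv P (DA P) \<and> rejected P (DA P) = {}"
  unfolding DA_def
proof (rule while_rule[where P = "DA_inv P"
      and r = "measure (\<lambda>\<mu>. \<Sum>i\<in>students P. card {s. (\<mu> i, s) \<in> pref P i})"])
qed (use DA_inv_init DA_step_inv DA_step_decreases in auto)

section \<open>Stability of the Deferred Acceptance matching\<close>

lemma card_assigned_le_capacity: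
  assumes none: "rejected P \<mu> = {}" and s: "s \<in> schools P"
  shows "enat (card (assigned P \<mu> s)) \<le> capacity P s"
proof (cases "assigned P \<mu> s = {}")
  case False
  let ?A = "assigned P \<mu> s"
  \<comment> \<open>All others in the pool outrank its last student \<open>m\<close>. Since
    \<open>m\<close> is not rejected, they number strictly less than the capacity, which leaves room
    for \<open>m\<close> herself.\<close>
  obtain m where m: "m \<in> ?A" "\<forall>b\<in>?A. b \<noteq> m \<longrightarrow> (b, m) \<in> priority P s"
    using slo_last[OF fin_students slo_priority[OF s] assigned_subset False] by blast
  then have "{j \<in> ?A. (j, m) \<in> priority P s} = ?A - {m}"
    using slo_irrefl[OF slo_priority[OF s]] by blast
  moreover have "m \<in> students P" "\<mu> m = s" using m(1) unfolding assigned_def by auto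
  ultimately have "enat (card (?A - {m})) < capacity P s"
    using none unfolding rejected_def by auto
  then have "eSuc (enat (card (?A - {m}))) \<le> capacity P s" by (rule ileI1)
  with m(1) show ?thesis
    using finite_assigned by (metis card_Suc_Diff1 eSuc_enat)
qed (simp add: zero_enat_def[symmetric])

text \<open>A squeeze: the invariant bounds the capacity by \<open>card ?H\<close>, termination
  bounds \<open>card ?A\<close> by the capacity, and \<open>?H\<close> is a subset of
  \<open>?A\<close>. Hence the two sets coincide.\<close>

lemma DA_no_justified_envy_or_waste: "no_justified_envy_or_waste P (DA P)"
  unfolding no_justified_envy_or_waste_def
proof (intro ballI allI impI)
  fix i s assume iI: "i \<in> students P" and s: "(s, DA P i) \<in> pref P i"
  let ?A = "assigned P (DA P) s"
  let ?H = "{j \<in> ?A. (j, i) \<in> priority P s}"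
  have sS: "s \<in> schools P" using pref_field[OF iI s] by blast
  have cap: "capacity P s \<le> enat (card ?H)"
    using DA_terminal iI s unfolding DA_inv_def by blast
  have "enat (card ?A) \<le> capacity P s"
    using card_assigned_le_capacity DA_terminal sS by blast
  from order_trans[OF this cap] have "card ?A \<le> card ?H" by simp
  then have H: "?H = ?A" by (rule card_seteq[OF finite_assigned Collect_restrict])
  with cap have "capacity P s \<le> enat (card ?A)" by simp
  moreover have "\<forall>j\<in>?A. (j, i) \<in> priority P s" using H by blast
  ultimately show "capacity P s \<le> enat (card ?A) \<and> (\<forall>j\<in>?A. (j, i) \<in> priority P s)" ..
qed

section \<open>Comparison with stable-dominating matchings\<close>

lemma rk_le_imp:
  assumes i: "i \<in> students P" and "s \<in> schools P" and "t \<in> schools P"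
    and le: "rk P i s \<le> rk P i t"
  shows "s = t \<or> (s, t) \<in> pref P i"
proof (rule ccontr)
  assume "\<not> (s = t \<or> (s, t) \<in> pref P i)"
  then have ts: "(t, s) \<in> pref P i"
    using slo_total[OF slo_pref[OF i]] assms(2,3) by blast
  \<comment> \<open>The cardinalities of these sets determine the ranks. The school \<open>t\<close>
    lies in the second set but not in the first, so the inclusion is strict.\<close>
  have "{u \<in> schools P. (u, t) \<in> pref P i} \<subseteq> {u \<in> schools P. (u, s) \<in> pref P i}"
    using pref_trans[OF i _ ts] by blast
  then have "{u \<in> schools P. (u, t) \<in> pref P i} \<subset> {u \<in> schools P. (u, s) \<in> pref P i}"
    using ts slo_irrefl[OF slo_pref[OF i]] assms(3) by blast
  then have "rk P i t < rk P i s"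
    unfolding rk_def using fin_schools by (simp add: psubset_card_mono)
  with le show False by simp
qed

lemma card_assigned_upper_set_eq:
  assumes \<mu>: "matching P \<mu>" and dom: "stable_dominating P \<mu>" and A: "A \<subseteq> students P"
    and upper: "\<And>s i j. s \<in> schools P \<Longrightarrow> i \<in> A \<Longrightarrow> (j, i) \<in> priority P s \<Longrightarrow> j \<in> A"
    and s: "s \<in> schools P"
  shows "card (assigned P \<mu> s \<inter> A) = card (assigned P (DA P) s \<inter> A)"
proof -
  have DA_sch: "\<forall>i\<in>students P. DA P i \<in> schools P"
    using DA_terminal unfolding DA_inv_def by blast
  have \<mu>_sch: "\<forall>i\<in>students P. \<mu> i \<in> schools P"
    using \<mu> unfolding matching_def by blast
  have le: "card (assigned P \<mu> t \<inter> A) \<le> card (assigned P (DA P) t \<inter> A)" if t: "t \<in> schools P" for t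
  proof (cases "assigned P \<mu> t \<inter> A \<subseteq> assigned P (DA P) t")
    case True
    then show ?thesis using finite_assigned by (intro card_mono) auto
  next
    case False
    then obtain i where i: "i \<in> students P" "\<mu> i = t" "i \<in> A" "DA P i \<noteq> t"
      unfolding assigned_def by blast
    then have "(t, DA P i) \<in> pref P i"
      using rk_le_imp[of i t "DA P i"] dom DA_sch t unfolding stable_dominating_def by metis
    then have full: "capacity P t \<le> enat (card (assigned P (DA P) t))"
      and above: "\<forall>j\<in>assigned P (DA P) t. (j, i) \<in> priority P t"
      using DA_no_justified_envy_or_waste i(1) unfolding no_justified_envy_or_waste_def by blast+
    have "enat (card (assigned P \<mu> t)) \<le> capacity P t"
      using \<mu> t unfolding matching_def by blast
    from order_trans[OF this full]
    have "card (assigned P \<mu> t) \<le> card (assigned P (DA P) t)" by simp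
    moreover have "card (assigned P \<mu> t \<inter> A) \<le> card (assigned P \<mu> t)"
      using finite_assigned by (intro card_mono) auto
    \<comment> \<open>Every student at \<open>t\<close> under \<open>DA P\<close> is above
      \<open>i\<close>, which lies in the upper set \<open>A\<close>, so intersecting with
      \<open>A\<close> loses nobody.\<close>
    moreover have "assigned P (DA P) t \<inter> A = assigned P (DA P) t"
      using above upper[OF t i(3)] by blast
    ultimately show ?thesis by simp
  qed
  \<comment> \<open>Both sums equal \<open>card A\<close>, so none of the termwise inequalities
    \<open>le\<close> can be strict.\<close>
  have "(\<Sum>t\<in>schools P. card (assigned P \<mu> t \<inter> A))
      = (\<Sum>t\<in>schools P. card (assigned P (DA P) t \<inter> A))"
    using sum_card_assigned[OF fin_students fin_schools _ A] DA_sch \<mu>_sch by simp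
  then show ?thesis by (rule sum_mono_inv[OF _ le s fin_schools])
qed

end

theorem theorem1:
  fixes P :: "('i, 's) school_choice" and Y Z :: "'i set"
  assumes "school_choice_problem P"
    and "students P = Y \<union> Z" and "Y \<inter> Z = {}" and "Y \<noteq> {}" and "Z \<noteq> {}"
    and "\<forall>s\<in>schools P. \<forall>y\<in>Y. \<forall>z\<in>Z. (y, z) \<in> priority P s"
  shows "(\<forall>M. stable_dominating_mechanism M \<longrightarrow> (\<forall>s\<in>schools P.
            card (assigned P (M P) s \<inter> Y) = card (assigned P (DA P) s \<inter> Y) \<and>
            card (assigned P (M P) s \<inter> Z) = card (assigned P (DA P) s \<inter> Z)))
       \<and> (\<forall>s\<in>schools P. fully_segregated P Y Z (DA P) s \<longrightarrow>
            (\<forall>M. stable_dominating_mechanism M \<longrightarrow> fully_segregated P Y Z (M P) s))"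
proof -
  have fin: "finite (assigned P \<mu> s)" for \<mu> s
    using finite_assigned[OF assms(1)] .
  have split: "card (assigned P \<mu> s \<inter> Z) = card (assigned P \<mu> s) - card (assigned P \<mu> s \<inter> Y)" for \<mu> s
  proof -
    have "assigned P \<mu> s \<inter> Z = assigned P \<mu> s - assigned P \<mu> s \<inter> Y"
      using assms(2,3) unfolding assigned_def by blast
    then show ?thesis using fin by (simp add: card_Diff_subset)
  qed
  have counts: "card (assigned P (M P) s \<inter> Y) = card (assigned P (DA P) s \<inter> Y) \<and>
      card (assigned P (M P) s \<inter> Z) = card (assigned P (DA P) s \<inter> Z)"
    if M: "stable_dominating_mechanism M" and s: "s \<in> schools P" for M s
  proof -
    have M_P: "matching P (M P)" "stable_dominating P (M P)"
      using M assms(1) unfolding stable_dominating_mechanism_def mechanism_def by auto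
    note slo = slo_priority[OF assms(1)]
    have Y: "card (assigned P (M P) s \<inter> Y) = card (assigned P (DA P) s \<inter> Y)"
    proof (rule card_assigned_upper_set_eq[OF assms(1) M_P _ _ s])
      show "Y \<subseteq> students P" using assms(2) by blast
      \<comment> \<open>A student \<open>j\<close> in \<open>Z\<close> would have lower priority
        than \<open>i\<close>; together with \<open>(j, i)\<close> this contradicts
        irreflexivity.\<close>
      fix t i j assume "t \<in> schools P" "i \<in> Y" "(j, i) \<in> priority P t"
      then show "j \<in> Y"
        using assms(2,6) slo_trans[OF slo] slo_irrefl[OF slo] slo_field[OF slo] by (metis UnE)
    qed
    have "card (assigned P (M P) s \<inter> students P) = card (assigned P (DA P) s \<inter> students P)"
      by (rule card_assigned_upper_set_eq[OF assms(1) M_P _ _ s])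
        (use slo_field[OF slo] in blast)+
    then have "card (assigned P (M P) s) = card (assigned P (DA P) s)"
      by (simp add: Int_absorb2 assigned_subset[OF assms(1)])
    with Y split show ?thesis by simp
  qed
  have "fully_segregated P Y Z (M P) s"
    if s: "s \<in> schools P" and seg: "fully_segregated P Y Z (DA P) s"
      and M: "stable_dominating_mechanism M" for M s
  proof -
    \<comment> \<open>Segregation is recast as emptiness of one intersection, that is, as a zero
      count, which \<open>counts\<close> carries over to \<open>M P\<close>.\<close>
    have "assigned P (DA P) s \<inter> Z = {} \<or> assigned P (DA P) s \<inter> Y = {}"
      using seg assms(3) unfolding fully_segregated_def by blast
    then have "assigned P (M P) s \<inter> Z = {} \<or> assigned P (M P) s \<inter> Y = {}"
      using counts[OF M s] fin by (metis card_0_eq card.empty finite_Int)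
    then show ?thesis
      using assms(2) unfolding fully_segregated_def assigned_def by blast
  qed
  with counts show ?thesis by blast
qed

end
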